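(* Let $\Xi$ be a stationary locally stable Gibbs process on $\mathbb{R}^d$ with intensity $\lambda$ and local stability constant $c^*>0$. Then for every $t\ge0$ its empty space function $F$ satisfies $$\frac{\lambda}{c^*}\bigl(1-\exp(-c^*\alpha_d t^d)\bigr)\;\le\;F(t)\;\le\;\lambda\,\alpha_d\,t^d,$$ where $\alpha_d$ denotes the volume of the unit ball in $\mathbb{R}^d$.
   Context: Let $\mathfrak{N}$ be the space of locally finite point measures on $\mathbb{R}^d$ with the $\sigma$-algebra generated by the evaluation maps $\xi\mapsto\xi(A)$, $A$ bounded Borel. A point process is a random element of $\mathfrak{N}$; all point processes are simple, so configurations are identified with locally finite sets. A point process $\Xi$ on $\mathbb{R}^d$ is a Gibbs process with conditional intensity $\lambda(\cdot\mid\cdot)\colon\mathbb{R}^d\times\mathfrak{N}\to[0,\infty)$ (measurable) if $$\mathbb{E}\Bigl(\int_{\mathbb{R}^d} h(x,\Xi\setminus\{x\})\,\Xi(dx)\Bigr)=\int_{\mathbb{R}^d}\mathbb{E}\bigl(h(x,\Xi)\lambda(x\mid\Xi)\bigr)\,dx$$ for all measurable $h\colon\mathbb{R}^d\times\mathfrak{N}\to[0,\infty)$. $\Xi$ need not be uniquely determined by $\lambda(\cdot\mid\cdot)$; results hold for every such process. $\Xi$ is stationary if its distribution is translation invariant. The intensity of a stationary $\Xi$ is the constant $\lambda=\mathbb{E}(\lambda(x\mid\Xi))$, i.e. $\mathbb{E}\,\Xi(A)=\lambda|A|$ for Borel sets $A$. A stationary Gibbs process is locally stable with constant $c^*$ if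 $\lambda(x\mid\xi)\le c^*$ for all $x\in\mathbb{R}^d$, $\xi\in\mathfrak{N}$. The empty space function of a stationary point process $\Xi$ is $F(t)=\mathbb{P}(\exists\,y\in\Xi\colon\|y\|\le t)$, $t\ge0$, the distribution function of the distance from the origin to the nearest point of $\Xi$. *)

theory Defs
  imports "HOL-Probability.Probability"
begin

text \<open>A point measure is a sum of Dirac measures; \<open>m x\<close> is the multiplicity of the atom \<open>x\<close>.\<close>

definition point_measures :: "'a::euclidean_space measure set" where
  "point_measures = {\<xi>. sets \<xi> = sets borel
     \<and> (\<exists>m :: 'a \<Rightarrow> nat. \<forall>A\<in>sets borel.
          emeasure \<xi> A = (\<integral>\<^sup>+x. of_nat (m x) * indicator A x \<partial>count_space UNIV))
     \<and> (\<forall>A\<in>sets borel. bounded A \<longrightarrow> emeasure \<xi> A < \<infinity>)}"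

definition config_space :: "'a::euclidean_space measure measure" where
  "config_space = sigma point_measures
     {{\<xi>\<in>point_measures. emeasure \<xi> A \<in> B} | A B.
        A \<in> sets borel \<and> bounded A \<and> B \<in> sets borel}"

definition points :: "'a::euclidean_space measure \<Rightarrow> 'a set" where
  "points \<xi> = {y. emeasure \<xi> {y} \<noteq> 0}"

definition simple_config :: "'a::euclidean_space measure \<Rightarrow> bool" where
  "simple_config \<xi> \<longleftrightarrow> (\<forall>x. emeasure \<xi> {x} \<le> 1)"

text \<open>The restriction of \<open>\<xi>\<close> to the complement of \<open>{x}\<close>, as a measure on the whole space.
  All atoms at \<open>x\<close> are deleted; for simple \<open>\<xi>\<close> there is at most one.\<close>

definition remove_point :: "'a::euclidean_space measure \<Rightarrow> 'a \<Rightarrow> 'a measure" where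
  "remove_point \<xi> x = density \<xi> (indicator (- {x}))"

definition translate :: "'a::euclidean_space \<Rightarrow> 'a measure \<Rightarrow> 'a measure" where
  "translate v \<xi> = distr \<xi> borel (\<lambda>x. x + v)"

definition point_process :: "'w measure \<Rightarrow> ('w \<Rightarrow> 'a::euclidean_space measure) \<Rightarrow> bool" where
  "point_process M \<Xi> \<longleftrightarrow> \<Xi> \<in> measurable M config_space \<and> (AE \<omega> in M. simple_config (\<Xi> \<omega>))"

definition stationary :: "'w measure \<Rightarrow> ('w \<Rightarrow> 'a::euclidean_space measure) \<Rightarrow> bool" where
  "stationary M \<Xi> \<longleftrightarrow>
     (\<forall>v. distr M config_space (\<lambda>\<omega>. translate v (\<Xi> \<omega>)) = distr M config_space \<Xi>)"

definition conditional_intensity :: "('a::euclidean_space \<Rightarrow> 'a measure \<Rightarrow> real) \<Rightarrow> bool" where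
  "conditional_intensity \<Lambda> \<longleftrightarrow>
     case_prod \<Lambda> \<in> borel_measurable (borel \<Otimes>\<^sub>M config_space)
     \<and> (\<forall>x. \<forall>\<xi>\<in>point_measures. 0 \<le> \<Lambda> x \<xi>)"

definition gibbs_process ::
  "'w measure \<Rightarrow> ('w \<Rightarrow> 'a::euclidean_space measure) \<Rightarrow> ('a \<Rightarrow> 'a measure \<Rightarrow> real) \<Rightarrow> bool" where
  "gibbs_process M \<Xi> \<Lambda> \<longleftrightarrow>
     point_process M \<Xi> \<and> conditional_intensity \<Lambda>
     \<and> (\<forall>h :: 'a \<Rightarrow> 'a measure \<Rightarrow> real.
          case_prod h \<in> borel_measurable (borel \<Otimes>\<^sub>M config_space)
          \<longrightarrow> (\<forall>x. \<forall>\<xi>\<in>point_measures. 0 \<le> h x \<xi>)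
          \<longrightarrow> (\<integral>\<^sup>+\<omega>. (\<integral>\<^sup>+x. ennreal (h x (remove_point (\<Xi> \<omega>) x)) \<partial>(\<Xi> \<omega>)) \<partial>M)
              = (\<integral>\<^sup>+x. (\<integral>\<^sup>+\<omega>. ennreal (h x (\<Xi> \<omega>) * \<Lambda> x (\<Xi> \<omega>)) \<partial>M) \<partial>lborel))"

definition locally_stable :: "('a::euclidean_space \<Rightarrow> 'a measure \<Rightarrow> real) \<Rightarrow> real \<Rightarrow> bool" where
  "locally_stable \<Lambda> c \<longleftrightarrow> (\<forall>x. \<forall>\<xi>\<in>point_measures. \<Lambda> x \<xi> \<le> c)"

text \<open>For a Gibbs process with conditional intensity \<open>\<Lambda>\<close> this says that the expectation of
  \<open>\<Lambda> x \<Xi>\<close> equals \<open>l\<close> for almost every \<open>x\<close>. It need not hold for every \<open>x\<close>, since \<open>\<Lambda>\<close> may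
  be altered on a Lebesgue null set of \<open>x\<close>.\<close>

definition has_intensity ::
  "'w measure \<Rightarrow> ('w \<Rightarrow> 'a::euclidean_space measure) \<Rightarrow> real \<Rightarrow> bool" where
  "has_intensity M \<Xi> l \<longleftrightarrow> 0 \<le> l
     \<and> (\<forall>A\<in>sets borel. (\<integral>\<^sup>+\<omega>. emeasure (\<Xi> \<omega>) A \<partial>M) = ennreal l * emeasure lborel A)"

definition empty_space_function ::
  "'w measure \<Rightarrow> ('w \<Rightarrow> 'a::euclidean_space measure) \<Rightarrow> real \<Rightarrow> real" where
  "empty_space_function M \<Xi> t = measure M {\<omega>\<in>space M. \<exists>y\<in>points (\<Xi> \<omega>). norm y \<le> t}"

end

theory Submission
  imports Defs
begin

text \<open>Write \<open>V r\<close> for the volume of the ball \<open>B r\<close> of radius \<open>r\<close> around the origin.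

  The upper bound is Markov's inequality: if \<open>\<Xi>\<close> meets \<open>B t\<close> then \<open>\<Xi> (B t) \<ge> 1\<close>, and the expected
  number of points in \<open>B t\<close> is \<open>l * V t\<close>.

  For the lower bound, the defining equation of the Gibbs process is applied to a function that
  picks out the point nearest to the origin, with a weight depending on its distance. With
  \<open>w x = exp (- c * (V t - V (norm x)))\<close>, let \<open>h x \<xi> = w x\<close> if \<open>norm x \<le> t\<close> and \<open>\<xi>\<close> has no point
  in \<open>B (norm x)\<close>, and \<open>h x \<xi> = 0\<close> otherwise. The sum of \<open>h x (\<xi> - {x})\<close> over the points \<open>x\<close> of
  \<open>\<xi>\<close> is then at most \<open>w z\<close>, where \<open>z\<close> is a nearest point. The weight is chosen so that the
  integral of \<open>c * w\<close> over the shell \<open>norm z \<le> norm x \<le> t\<close> is exactly \<open>1 - w z\<close>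
  (\<open>nn_integral_shell_weight\<close>; in the radial coordinate \<open>v = V (norm x)\<close> Lebesgue measure becomes
  \<open>dv\<close>). That shell is the set of all \<open>x\<close> in \<open>B t\<close> for which \<open>\<xi>\<close> does meet \<open>B (norm x)\<close>, so for
  every simple configuration (\<open>nearest_weight_balance\<close>)
  \<open>(sum of h x (\<xi> - {x})) + (integral of c * w over the x with \<xi> (B (norm x)) > 0) \<le> 1\<close>,
  and the left-hand side vanishes if \<open>\<xi>\<close> misses \<open>B t\<close>.

  Taking expectations turns the right-hand side into \<open>F t\<close> and the first summand into the integral
  of \<open>E (h x \<Xi> * \<Lambda> x \<Xi>)\<close>. Since \<open>\<Lambda> \<le> c\<close>, the integrand \<open>c * w x\<close> of the second summand dominates
  \<open>w x * \<Lambda> x \<Xi>\<close> on the part of \<open>B t\<close> where \<open>h\<close> vanishes. The two summands together thus dominate the integral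
  of \<open>w x * E (\<Lambda> x \<Xi>)\<close> over \<open>B t\<close>, which is \<open>l\<close> times the integral of \<open>w\<close>
  (\<open>expected_conditional_intensity\<close>), that is \<open>l / c * (1 - exp (- c * V t))\<close>.\<close>

section \<open>Configurations\<close>

lemma sets_point_measure: "\<xi> \<in> point_measures \<Longrightarrow> sets \<xi> = sets borel"
  by (simp add: point_measures_def)

lemma emeasure_bounded_finite:
  "\<xi> \<in> point_measures \<Longrightarrow> A \<in> sets borel \<Longrightarrow> bounded A \<Longrightarrow> emeasure \<xi> A < \<infinity>"
  by (simp add: point_measures_def)

text \<open>Atoms have integer mass and bounded sets have finite mass, so a ball holds only finitely many
  atoms and one of them is nearest to the origin. There may be ties.\<close>

lemma nearest_atom:
  fixes \<xi> :: "'a::euclidean_space measure"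
  assumes \<xi>: "\<xi> \<in> point_measures" and ne: "emeasure \<xi> (cball 0 t) \<noteq> 0"
  obtains x where "norm x \<le> t" "1 \<le> emeasure \<xi> {x}" "emeasure \<xi> (ball 0 (norm x)) = 0"
proof -
  obtain m :: "'a \<Rightarrow> nat" where m: "\<And>A. A \<in> sets borel \<Longrightarrow>
      emeasure \<xi> A = (\<integral>\<^sup>+x. of_nat (m x) * indicator A x \<partial>count_space UNIV)"
    using \<xi> by (auto simp: point_measures_def)
  define T where "T = {x \<in> cball 0 t. m x \<noteq> 0}"
  have single: "emeasure \<xi> {x} = of_nat (m x)" for x
    using m[of "{x}"] by (simp add: one_ennreal_def[symmetric])
  have null: "emeasure \<xi> A = 0" if "A \<in> sets borel" "\<And>x. x \<in> A \<Longrightarrow> m x = 0" for A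
  proof -
    have "emeasure \<xi> A = (\<integral>\<^sup>+x. 0 \<partial>count_space (UNIV::'a set))"
      unfolding m[OF that(1)] by (intro nn_integral_cong) (auto simp: indicator_def that(2))
    then show ?thesis by simp
  qed
  have "emeasure (count_space UNIV) T = (\<integral>\<^sup>+x. indicator T x \<partial>count_space UNIV)"
    by simp
  also have "\<dots> \<le> (\<integral>\<^sup>+x. of_nat (m x) * indicator (cball 0 t) x \<partial>count_space UNIV)"
    by (intro nn_integral_mono) (auto simp: T_def indicator_def Suc_le_eq)
  also have "\<dots> = emeasure \<xi> (cball 0 t)" by (simp add: m)
  also have "\<dots> < \<infinity>" by (rule emeasure_bounded_finite[OF \<xi>]) auto
  finally have fin: "finite T" by (auto simp: emeasure_count_space split: if_splits)
  have "T \<noteq> {}" using null[of "cball 0 t"] ne by (force simp: T_def)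
  then obtain x where x: "x \<in> T" "\<And>y. y \<in> T \<Longrightarrow> norm x \<le> norm y"
    using fin by (metis arg_min_if_finite(1) arg_min_least)
  show ?thesis
  proof
    show "norm x \<le> t" using x by (simp add: T_def)
    show "1 \<le> emeasure \<xi> {x}" using x(1) by (simp add: T_def single Suc_le_eq)
    show "emeasure \<xi> (ball 0 (norm x)) = 0"
    proof (rule null)
      fix y :: 'a assume y: "y \<in> ball 0 (norm x)"
      show "m y = 0"
      proof (rule ccontr)
        assume "m y \<noteq> 0"
        then have "y \<in> T" using y x(1) by (auto simp: T_def)
        then show False using x(2)[of y] y by simp
      qed
    qed simp
  qed
qed

lemma points_cball_iff:
  assumes \<xi>: "\<xi> \<in> point_measures"
  shows "(\<exists>y\<in>points \<xi>. norm y \<le> t) \<longleftrightarrow> emeasure \<xi> (cball 0 t) \<noteq> 0"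
proof
  assume "\<exists>y\<in>points \<xi>. norm y \<le> t"
  then obtain y where y: "emeasure \<xi> {y} \<noteq> 0" "norm y \<le> t" by (auto simp: points_def)
  have "emeasure \<xi> {y} \<le> emeasure \<xi> (cball 0 t)"
    using y by (intro emeasure_mono) (auto simp: sets_point_measure[OF \<xi>])
  with y show "emeasure \<xi> (cball 0 t) \<noteq> 0" by auto
next
  assume "emeasure \<xi> (cball 0 t) \<noteq> 0"
  from nearest_atom[OF \<xi> this] show "\<exists>y\<in>points \<xi>. norm y \<le> t"
    by (metis (mono_tags, lifting) mem_Collect_eq not_one_le_zero points_def)
qed

lemma space_config_space: "space config_space = point_measures"
  unfolding config_space_def by (intro space_measure_of) auto

lemma measurable_emeasure_config:
  fixes A :: "'a::euclidean_space set"
  assumes "A \<in> sets borel" "bounded A"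
  shows "(\<lambda>\<xi>. emeasure \<xi> A) \<in> borel_measurable config_space"
proof (rule measurableI)
  fix B :: "ennreal set" assume B: "B \<in> sets borel"
  have "{\<xi>\<in>point_measures. emeasure \<xi> A \<in> B} \<in> sets config_space"
    unfolding config_space_def using assms B
    by (subst sets_measure_of) auto
  then show "(\<lambda>\<xi>. emeasure \<xi> A) -` B \<inter> space config_space \<in> sets config_space"
    by (simp add: space_config_space vimage_def Int_def conj_commute)
qed simp

text \<open>For a fixed configuration the mass of \<^term>\<open>cball 0 r\<close> is right-continuous in \<open>r\<close>, because
  bounded sets have finite mass. So it is below \<open>a\<close> exactly if it is below \<open>a\<close> for some larger
  rational radius, and joint measurability reduces to countably many fixed radii.\<close>

lemma measurable_emeasure_cball_config:
  "(\<lambda>(r, \<xi>). emeasure \<xi> (cball (0::'a::euclidean_space) r))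
     \<in> borel_measurable (borel \<Otimes>\<^sub>M config_space)"
proof (rule borel_measurableI_less)
  fix a :: ennreal
  let ?P = "borel \<Otimes>\<^sub>M config_space :: (real \<times> 'a measure) measure"
  have eq: "emeasure \<xi> (cball 0 r) < a \<longleftrightarrow> (\<exists>q\<in>\<rat>. r < q \<and> emeasure \<xi> (cball 0 q) < a)"
    if \<xi>: "\<xi> \<in> point_measures" for r and \<xi> :: "'a measure"
  proof
    assume "\<exists>q\<in>\<rat>. r < q \<and> emeasure \<xi> (cball 0 q) < a"
    then obtain q where q: "r < q" "emeasure \<xi> (cball 0 q) < a" by auto
    have "emeasure \<xi> (cball 0 r) \<le> emeasure \<xi> (cball 0 q)"
      using q by (intro emeasure_mono) (auto simp: sets_point_measure[OF \<xi>])
    with q show "emeasure \<xi> (cball 0 r) < a" by auto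
  next
    assume lt: "emeasure \<xi> (cball 0 r) < a"
    let ?C = "\<lambda>n. cball (0::'a) (r + 1 / real (Suc n))"
    have "(\<Inter>n. ?C n) = cball 0 r"
    proof (intro equalityI subsetI)
      fix x assume x: "x \<in> (\<Inter>n. ?C n)"
      have "norm x \<le> r + e" if e: "e > 0" for e
      proof -
        obtain n where "1 / real (Suc n) < e"
          using reals_Archimedean[OF e] by (auto simp: inverse_eq_divide)
        moreover have "norm x \<le> r + 1 / real (Suc n)" using x by auto
        ultimately show ?thesis by linarith
      qed
      then show "x \<in> cball 0 r" using field_le_epsilon by auto
    next
      fix x :: 'a assume "x \<in> cball 0 r"
      moreover have "r \<le> r + 1 / real (Suc n)" for n by simp
      ultimately show "x \<in> (\<Inter>n. ?C n)" by (auto intro: order_trans)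
    qed
    moreover have "(INF n. emeasure \<xi> (?C n)) = emeasure \<xi> (\<Inter>n. ?C n)"
    proof (rule INF_emeasure_decseq)
      show "decseq ?C"
        by (intro antimonoI subset_cball) (auto intro!: divide_left_mono)
      show "emeasure \<xi> (?C i) \<noteq> \<infinity>" for i
        using emeasure_bounded_finite[OF \<xi>, of "?C i"] by auto
    qed (auto simp: sets_point_measure[OF \<xi>])
    ultimately have "(INF n. emeasure \<xi> (?C n)) < a" using lt by simp
    then obtain n where n: "emeasure \<xi> (?C n) < a" by (auto simp: INF_less_iff)
    obtain q where q: "q \<in> \<rat>" "r < q" "q < r + 1 / real (Suc n)"
      using Rats_dense_in_real[of r "r + 1 / real (Suc n)"] by auto
    have "emeasure \<xi> (cball 0 q) \<le> emeasure \<xi> (?C n)"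
      using q by (intro emeasure_mono) (auto simp: sets_point_measure[OF \<xi>])
    with n q show "\<exists>q\<in>\<rat>. r < q \<and> emeasure \<xi> (cball 0 q) < a" by auto
  qed
  have "{z \<in> space ?P. (case z of (r, \<xi>) \<Rightarrow> emeasure \<xi> (cball 0 r)) < a} =
      (\<Union>q\<in>\<rat>. {..<q} \<times> {\<xi>\<in>space config_space. emeasure \<xi> (cball (0::'a) q) < a})"
    using eq by (auto simp: space_pair_measure space_config_space)
  also have "\<dots> \<in> sets ?P"
  proof (rule sets.countable_UN''[OF countable_rat])
    fix q :: real
    have [measurable]: "(\<lambda>\<xi>. emeasure \<xi> (cball (0::'a) q)) \<in> borel_measurable config_space"
      by (intro measurable_emeasure_config) auto
    have "{\<xi> \<in> space config_space. emeasure \<xi> (cball (0::'a) q) < a} \<in> sets config_space"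
      by measurable
    then show "{..<q} \<times> {\<xi>\<in>space config_space. emeasure \<xi> (cball (0::'a) q) < a} \<in> sets ?P"
      by (intro pair_measureI) auto
  qed
  finally show "{z \<in> space ?P. (case z of (r, \<xi>) \<Rightarrow> emeasure \<xi> (cball 0 r)) < a} \<in> sets ?P" .
qed

section \<open>Volume as radial coordinate\<close>

definition enclosed_volume :: "'a::euclidean_space \<Rightarrow> real" where
  "enclosed_volume x = unit_ball_vol DIM('a) * norm x ^ DIM('a)"

lemma enclosed_volume_measurable [measurable]: "enclosed_volume \<in> borel_measurable borel"
  unfolding enclosed_volume_def by measurable

text \<open>Restricting to a ball keeps both measures finite, so that they are determined by their values
  on the half-lines \<open>{u<..}\<close>; there both give the volume of a spherical shell.\<close>

lemma distr_enclosed_volume: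
  assumes t: "0 \<le> t"
  shows "distr (density lborel (indicator (cball (0::'a::euclidean_space) t))) borel enclosed_volume
       = density lborel (indicator {0..unit_ball_vol DIM('a) * t ^ DIM('a)})"
    (is "?L = ?R")
proof -
  let ?b = "unit_ball_vol DIM('a)" and ?d = "DIM('a)"
  let ?s = "?b * t ^ ?d"
  have b: "?b > 0" by simp
  have s: "0 \<le> ?s" using t b by (intro mult_nonneg_nonneg) auto
  have vol: "emeasure lborel (cball (0::'a) r) = ennreal (?b * r ^ ?d)" if "0 \<le> r" for r
    using that by (rule emeasure_cball)
  have L: "emeasure ?L {u<..} = emeasure lborel (cball (0::'a) t \<inter> {x. u < enclosed_volume x})" for u
  proof -
    have "emeasure ?L {u<..} = emeasure (density lborel (indicator (cball (0::'a) t)))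
        {x. u < enclosed_volume x}"
      by (subst emeasure_distr) (auto simp: vimage_def)
    also have "\<dots> = emeasure lborel (cball (0::'a) t \<inter> {x. u < enclosed_volume x})"
      by (subst emeasure_restricted) (auto simp: Int_def)
    finally show ?thesis .
  qed
  have R: "emeasure ?R {u<..} = emeasure lborel ({0..?s} \<inter> {u<..})" for u
    by (subst emeasure_restricted) auto
  have eq: "emeasure ?L {u<..} = emeasure ?R {u<..}" for u
  proof (cases "u < 0")
    case True
    then have "u < enclosed_volume x" for x :: 'a
      using b by (auto simp: enclosed_volume_def intro!: order.strict_trans2[OF True])
    then have "emeasure ?L {u<..} = ennreal ?s" by (simp add: L vol[OF t])
    moreover have "{0..?s} \<inter> {u<..} = {0..?s}" using True by auto
    ultimately show ?thesis using s by (simp add: R)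
  next
    case False
    then have u: "0 \<le> u" by simp
    define r where "r = root ?d (u / ?b)"
    have r: "0 \<le> r" "?b * r ^ ?d = u" using u b by (auto simp: r_def simp del: unit_ball_vol_pos)
    have lt: "u < enclosed_volume x \<longleftrightarrow> r < norm x" for x :: 'a
      unfolding enclosed_volume_def r(2)[symmetric] using b r(1)
      by (simp add: not_le[symmetric])
    have set: "cball (0::'a) t \<inter> {x. u < enclosed_volume x} = cball 0 t - cball 0 r"
      by (auto simp: lt)
    show ?thesis
    proof (cases "r \<le> t")
      case True
      then have us: "u \<le> ?s"
        unfolding r(2)[symmetric] using b r(1) by (intro mult_left_mono power_mono) auto
      have "emeasure lborel (cball (0::'a) t - cball 0 r) = ennreal ?s - ennreal u"
        using True by (subst emeasure_Diff) (auto simp: vol r t)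
      also have "\<dots> = ennreal (?s - u)" by (rule ennreal_minus[OF u])
      moreover have "{0..?s} \<inter> {u<..} = {u<..?s}" using u by auto
      ultimately show ?thesis using us by (simp add: L R set)
    next
      case False
      then have "?s < u"
        unfolding r(2)[symmetric] using b t by (intro mult_strict_left_mono power_strict_mono) auto
      then have "{0..?s} \<inter> {u<..} = {}" by auto
      moreover have "cball (0::'a) t - cball 0 r = {}"
        using False by (auto)
      ultimately show ?thesis unfolding L R set by (simp only: emeasure_empty)
    qed
  qed
  show ?thesis
  proof (rule measure_eqI_lessThan)
    fix u
    have "emeasure ?L {u<..} \<le> emeasure lborel (cball (0::'a) t)"
      unfolding L by (intro emeasure_mono) auto
    also have "\<dots> < \<infinity>" by (simp add: vol[OF t])
    finally show "emeasure ?L {u<..} < \<infinity>" .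
  qed (auto simp: eq)
qed

text \<open>As a function of the enclosed volume \<open>v\<close> the weight solves \<open>w' = c * w\<close> and equals 1 on the
  sphere of radius \<open>t\<close>.\<close>

definition shell_weight :: "real \<Rightarrow> real \<Rightarrow> 'a::euclidean_space \<Rightarrow> real" where
  "shell_weight c t x = exp (- c * (unit_ball_vol DIM('a) * t ^ DIM('a) - enclosed_volume x))"

lemma shell_weight_measurable [measurable]: "shell_weight c t \<in> borel_measurable borel"
  unfolding shell_weight_def by measurable

lemma shell_weight_nonneg: "0 \<le> shell_weight c t x"
  by (simp add: shell_weight_def)

lemma nn_integral_shell_weight:
  fixes c t r :: real
  assumes c: "0 \<le> c" and r: "0 \<le> r" "r \<le> t"
  defines "V \<equiv> \<lambda>r. unit_ball_vol DIM('a) * r ^ DIM('a)"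
  shows "(\<integral>\<^sup>+x. ennreal (c * shell_weight c t x) * indicator {x. r \<le> norm x \<and> norm x \<le> t} x
            \<partial>(lborel :: 'a::euclidean_space measure))
         = ennreal (1 - exp (- c * (V t - V r)))"
proof -
  have t: "0 \<le> t" using r by simp
  have b: "unit_ball_vol DIM('a) > 0" by simp
  have V: "V r \<le> V t" "0 \<le> V r"
    using r b unfolding V_def by (auto intro!: mult_left_mono power_mono)
  let ?f = "\<lambda>v. ennreal (c * exp (- c * (V t - v))) * indicator {V r..} v"
  have le: "r \<le> norm x \<longleftrightarrow> V r \<le> enclosed_volume x" for x :: 'a
    unfolding enclosed_volume_def V_def using b r by simp
  have "(\<integral>\<^sup>+x. ennreal (c * shell_weight c t x) * indicator {x. r \<le> norm x \<and> norm x \<le> t} x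
            \<partial>(lborel :: 'a measure))
      = (\<integral>\<^sup>+x. indicator (cball 0 t) x * ?f (enclosed_volume x) \<partial>(lborel :: 'a measure))"
    by (intro nn_integral_cong) (auto simp: indicator_def shell_weight_def V_def le)
  also have "\<dots> = (\<integral>\<^sup>+v. ?f v
      \<partial>distr (density lborel (indicator (cball (0::'a) t))) borel enclosed_volume)"
    by (subst nn_integral_distr, measurable, subst nn_integral_density)
       (auto intro!: borel_measurable_indicator)
  also have "\<dots> = (\<integral>\<^sup>+v. indicator {0..V t} v * ?f v \<partial>lborel)"
    unfolding distr_enclosed_volume[OF t] V_def by (subst nn_integral_density) auto
  also have "\<dots> = (\<integral>\<^sup>+v. ennreal (c * exp (- c * (V t - v))) * indicator {V r..V t} v \<partial>lborel)"
    using V by (intro nn_integral_cong) (auto simp: indicator_def)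
  also have "\<dots> = ennreal (exp (- c * (V t - V t)) - exp (- c * (V t - V r)))"
    using V c by (intro nn_integral_FTC_Icc) (auto intro!: derivative_eq_intros)
  finally show ?thesis by simp
qed

section \<open>Weighting the nearest point\<close>

definition nearest_weight :: "real \<Rightarrow> real \<Rightarrow> 'a::euclidean_space \<Rightarrow> 'a measure \<Rightarrow> real" where
  "nearest_weight c t x \<xi> =
     (if norm x \<le> t \<and> emeasure \<xi> (cball 0 (norm x)) = 0 then shell_weight c t x else 0)"

lemma measurable_emeasure_cball_norm:
  "(\<lambda>(x::'a::euclidean_space, \<xi>::'a measure). emeasure \<xi> (cball 0 (norm x)))
     \<in> borel_measurable (borel \<Otimes>\<^sub>M config_space)"
proof -
  have "(\<lambda>(x::'a, \<xi>::'a measure). (norm x, \<xi>)) \<in> borel \<Otimes>\<^sub>M config_space \<rightarrow>\<^sub>M borel \<Otimes>\<^sub>M config_space"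
    by measurable
  from measurable_compose[OF this measurable_emeasure_cball_config] show ?thesis
    by (simp add: case_prod_unfold)
qed

lemma nearest_weight_measurable:
  "case_prod (nearest_weight c t) \<in> borel_measurable (borel \<Otimes>\<^sub>M config_space)"
proof -
  note [measurable] = measurable_emeasure_cball_norm[unfolded case_prod_unfold]
  show ?thesis unfolding nearest_weight_def case_prod_unfold by measurable
qed

text \<open>If \<open>z\<close> is a nearest atom, only \<open>z\<close> can contribute to the first integral, with at most the
  weight of \<open>z\<close> by simplicity, while the second integral is over the shell beyond \<open>z\<close> and equals
  1 minus that weight. If two points are nearest, the first integral is 0: each of them
  lies in the closed ball of the other.\<close>

lemma nearest_weight_balance:
  fixes \<xi> :: "'a::euclidean_space measure"
  assumes \<xi>: "\<xi> \<in> point_measures" and simple: "simple_config \<xi>" and c: "0 \<le> c"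
  shows "(\<integral>\<^sup>+x. ennreal (nearest_weight c t x (remove_point \<xi> x)) \<partial>\<xi>)
       + (\<integral>\<^sup>+x. ennreal (c * shell_weight c t x) *
            indicator {x::'a. norm x \<le> t \<and> emeasure \<xi> (cball 0 (norm x)) \<noteq> 0} x \<partial>lborel)
       \<le> of_bool (emeasure \<xi> (cball 0 t) \<noteq> 0)"
    (is "?A + ?B \<le> _")
proof -
  note sets = sets_point_measure[OF \<xi>]
  have mono: "emeasure \<xi> A \<le> emeasure \<xi> B" if "A \<subseteq> B" "B \<in> sets borel" for A B
    using that by (intro emeasure_mono) (auto simp: sets)
  have removed: "emeasure (remove_point \<xi> x) A = emeasure \<xi> (A - {x})"
    if "A \<in> sets borel" for x A
    unfolding remove_point_def using that
    by (subst emeasure_restricted) (auto simp: sets Int_commute Diff_eq)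
  show ?thesis
  proof (cases "emeasure \<xi> (cball 0 t) = 0")
    case True
    have null: "emeasure \<xi> (cball 0 r) = 0" if "r \<le> t" for r
    proof -
      have "emeasure \<xi> (cball 0 r) \<le> emeasure \<xi> (cball 0 t)"
        using that by (intro mono subset_cball) auto
      then show ?thesis using True by simp
    qed
    have "AE x in \<xi>. x \<notin> cball 0 t"
      using True by (intro AE_not_in) (auto simp: null_sets_def sets)
    then have "?A = (\<integral>\<^sup>+x. 0 \<partial>\<xi>)"
      by (intro nn_integral_cong_AE) (auto simp: nearest_weight_def)
    moreover have "?B = (\<integral>\<^sup>+x. 0 \<partial>(lborel::'a measure))"
      by (rule nn_integral_cong) (simp add: indicator_def null)
    ultimately show ?thesis by simp
  next
    case False
    obtain z where z: "norm z \<le> t" "1 \<le> emeasure \<xi> {z}" "emeasure \<xi> (ball 0 (norm z)) = 0"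
      using nearest_atom[OF \<xi> False] .
    let ?V = "\<lambda>r. unit_ball_vol DIM('a) * r ^ DIM('a)"
    have pos: "emeasure \<xi> A \<noteq> 0" if "z \<in> A" "A \<in> sets borel" for A
      using z(2) mono[of "{z}" A] that by (auto dest: order_trans)
    have "AE x in \<xi>. x \<notin> ball 0 (norm z)"
      using z(3) by (intro AE_not_in) (auto simp: null_sets_def sets)
    then have "?A \<le> (\<integral>\<^sup>+x. ennreal (shell_weight c t z) * indicator {z} x \<partial>\<xi>)"
    proof (intro nn_integral_mono_AE, eventually_elim)
      fix x :: 'a assume x: "x \<notin> ball 0 (norm z)"
      have "emeasure (remove_point \<xi> x) (cball 0 (norm x)) \<noteq> 0" if "x \<noteq> z"
        using pos[of "cball 0 (norm x) - {x}"] x that by (simp add: removed)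
      then show "ennreal (nearest_weight c t x (remove_point \<xi> x))
          \<le> ennreal (shell_weight c t z) * indicator {z} x"
        by (cases "x = z") (auto simp: nearest_weight_def)
    qed
    also have "\<dots> = ennreal (shell_weight c t z) * emeasure \<xi> {z}"
      by (subst nn_integral_cmult_indicator) (auto simp: sets)
    also have "\<dots> \<le> ennreal (shell_weight c t z) * 1"
      using simple by (intro mult_left_mono) (auto simp: simple_config_def)
    finally have A: "?A \<le> ennreal (shell_weight c t z)" by simp
    have seen: "emeasure \<xi> (cball 0 (norm x)) \<noteq> 0 \<longleftrightarrow> norm z \<le> norm x" for x :: 'a
    proof
      assume "emeasure \<xi> (cball 0 (norm x)) \<noteq> 0"
      then have "\<not> cball 0 (norm x) \<subseteq> ball (0::'a) (norm z)" using mono[of _ "ball 0 (norm z)"] z(3) by auto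
      then show "norm z \<le> norm x" by auto
    qed (use pos[of "cball 0 (norm x)"] in auto)
    have "?B = (\<integral>\<^sup>+x. ennreal (c * shell_weight c t x) *
            indicator {x. norm z \<le> norm x \<and> norm x \<le> t} x \<partial>(lborel::'a measure))"
      unfolding seen by (simp add: conj_commute)
    also have "\<dots> = ennreal (1 - exp (- c * (?V t - ?V (norm z))))"
      using z(1) c by (intro nn_integral_shell_weight) auto
    also have "\<dots> = ennreal (1 - shell_weight c t z)"
      by (simp add: shell_weight_def enclosed_volume_def)
    finally have B: "?B = ennreal (1 - shell_weight c t z)" .
    have "?V (norm z) \<le> ?V t" using z(1) by (intro mult_left_mono power_mono) auto
    then have "shell_weight c t z \<le> 1"
      using c by (auto simp: shell_weight_def enclosed_volume_def)
    then have "ennreal (shell_weight c t z) + ennreal (1 - shell_weight c t z) = 1"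
      by (subst ennreal_plus[symmetric]) (auto simp: shell_weight_nonneg)
    then show ?thesis using add_right_mono[OF A, of "ennreal (1 - shell_weight c t z)"] False by (simp add: B)
  qed
qed

section \<open>The empty space function\<close>

text \<open>For an indicator \<open>f\<close> this is the Gibbs equation for \<open>h x \<xi> = f x\<close>. Hence the measures with
  densities \<open>E (\<Lambda> x \<Xi>)\<close> and \<open>l\<close> coincide, which gives every other \<open>f\<close>.\<close>

lemma expected_conditional_intensity:
  fixes \<Xi> :: "'w \<Rightarrow> 'a::euclidean_space measure"
  assumes M: "prob_space M" and gibbs: "gibbs_process M \<Xi> \<Lambda>" and int: "has_intensity M \<Xi> l"
    and f: "f \<in> borel_measurable borel"
  shows "(\<integral>\<^sup>+x. f x * (\<integral>\<^sup>+\<omega>. ennreal (\<Lambda> x (\<Xi> \<omega>)) \<partial>M) \<partial>lborel) = ennreal l * (\<integral>\<^sup>+x. f x \<partial>lborel)"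
proof -
  interpret prob_space M by fact
  have \<Xi> [measurable]: "\<Xi> \<in> measurable M config_space"
    using gibbs by (auto simp: gibbs_process_def point_process_def)
  have [measurable]: "case_prod \<Lambda> \<in> borel_measurable (borel \<Otimes>\<^sub>M config_space)"
    using gibbs by (auto simp: gibbs_process_def conditional_intensity_def)
  have sets: "sets (\<Xi> \<omega>) = sets borel" if "\<omega> \<in> space M" for \<omega>
    using measurable_space[OF \<Xi> that] by (simp add: space_config_space sets_point_measure)
  let ?g = "\<lambda>x. \<integral>\<^sup>+\<omega>. ennreal (\<Lambda> x (\<Xi> \<omega>)) \<partial>M"
  have g [measurable]: "?g \<in> borel_measurable borel" by measurable
  have "density lborel ?g = density lborel (\<lambda>_. ennreal l)"
  proof (rule measure_eqI)
    fix A :: "'a set" assume "A \<in> sets (density lborel ?g)"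
    then have A [measurable]: "A \<in> sets borel" by simp
    have "emeasure (density lborel ?g) A = (\<integral>\<^sup>+x. ?g x * indicator A x \<partial>lborel)"
      by (subst emeasure_density) auto
    also have "\<dots> = (\<integral>\<^sup>+x. (\<integral>\<^sup>+\<omega>. ennreal (indicator A x * \<Lambda> x (\<Xi> \<omega>)) \<partial>M) \<partial>lborel)"
      by (intro nn_integral_cong) (auto simp: indicator_def)
    also have "\<dots> = (\<integral>\<^sup>+\<omega>. (\<integral>\<^sup>+x. ennreal (indicator A x) \<partial>(\<Xi> \<omega>)) \<partial>M)"
    proof -
      have "case_prod (\<lambda>x (\<xi>::'a measure). indicator A x :: real)
          \<in> borel_measurable (borel \<Otimes>\<^sub>M config_space)" by measurable
      with gibbs show ?thesis
        unfolding gibbs_process_def by (elim conjE allE[where x = "\<lambda>x _. indicator A x"]) auto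
    qed
    also have "\<dots> = (\<integral>\<^sup>+\<omega>. emeasure (\<Xi> \<omega>) A \<partial>M)"
      by (intro nn_integral_cong) (auto simp: ennreal_indicator sets)
    also have "\<dots> = ennreal l * emeasure lborel A"
      using int A by (auto simp: has_intensity_def)
    also have "\<dots> = emeasure (density lborel (\<lambda>_. ennreal l)) A"
      by (subst emeasure_density) (auto simp: nn_integral_cmult_indicator)
    finally show "emeasure (density lborel ?g) A = emeasure (density lborel (\<lambda>_. ennreal l)) A" .
  qed simp
  moreover have "(\<integral>\<^sup>+x. f x * ?g x \<partial>lborel) = (\<integral>\<^sup>+x. f x \<partial>density lborel ?g)"
    using f by (subst nn_integral_density) (auto simp: mult.commute)
  ultimately show ?thesis
    using f by (simp add: nn_integral_density nn_integral_cmult)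
qed

lemma contact_set_measurable:
  fixes \<Xi> :: "'w \<Rightarrow> 'a::euclidean_space measure"
  assumes "\<Xi> \<in> measurable M config_space"
  shows "{\<omega>\<in>space M. emeasure (\<Xi> \<omega>) (cball 0 t) \<noteq> 0} \<in> sets M"
proof -
  have [measurable]: "(\<lambda>\<omega>. emeasure (\<Xi> \<omega>) (cball 0 t)) \<in> borel_measurable M"
    by (rule measurable_compose[OF assms measurable_emeasure_config]) auto
  show ?thesis by measurable
qed

lemma emeasure_contact:
  fixes \<Xi> :: "'w \<Rightarrow> 'a::euclidean_space measure"
  assumes M: "prob_space M" and \<Xi>: "\<Xi> \<in> measurable M config_space"
  shows "ennreal (empty_space_function M \<Xi> t) = (\<integral>\<^sup>+\<omega>. of_bool (emeasure (\<Xi> \<omega>) (cball 0 t) \<noteq> 0) \<partial>M)"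
proof -
  interpret prob_space M by fact
  let ?E = "{\<omega>\<in>space M. emeasure (\<Xi> \<omega>) (cball 0 t) \<noteq> 0}"
  have "{\<omega>\<in>space M. \<exists>y\<in>points (\<Xi> \<omega>). norm y \<le> t} = ?E"
    using measurable_space[OF \<Xi>]
    by (intro Collect_cong conj_cong refl points_cball_iff) (simp add: space_config_space)
  then have "ennreal (empty_space_function M \<Xi> t) = emeasure M ?E"
    by (simp add: empty_space_function_def emeasure_eq_measure)
  also have "\<dots> = (\<integral>\<^sup>+\<omega>. indicator ?E \<omega> \<partial>M)"
    using contact_set_measurable[OF \<Xi>] by simp
  also have "\<dots> = (\<integral>\<^sup>+\<omega>. of_bool (emeasure (\<Xi> \<omega>) (cball 0 t) \<noteq> 0) \<partial>M)"
    by (intro nn_integral_cong) (auto simp: indicator_def)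
  finally show ?thesis .
qed

lemma empty_space_function_upper:
  fixes \<Xi> :: "'w \<Rightarrow> 'a::euclidean_space measure"
  assumes M: "prob_space M" and \<Xi>: "\<Xi> \<in> measurable M config_space"
    and int: "has_intensity M \<Xi> l" and t: "0 \<le> t"
  shows "empty_space_function M \<Xi> t \<le> l * (unit_ball_vol DIM('a) * t ^ DIM('a))"
proof -
  have l: "0 \<le> l" using int by (simp add: has_intensity_def)
  have "ennreal (empty_space_function M \<Xi> t) \<le> (\<integral>\<^sup>+\<omega>. emeasure (\<Xi> \<omega>) (cball 0 t) \<partial>M)"
    unfolding emeasure_contact[OF M \<Xi>]
  proof (intro nn_integral_mono)
    fix \<omega> assume "\<omega> \<in> space M"
    then have pm: "\<Xi> \<omega> \<in> point_measures"
      using measurable_space[OF \<Xi>] by (simp add: space_config_space)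
    show "of_bool (emeasure (\<Xi> \<omega>) (cball 0 t) \<noteq> 0) \<le> emeasure (\<Xi> \<omega>) (cball 0 t)"
    proof (cases "emeasure (\<Xi> \<omega>) (cball 0 t) = 0")
      case False
      then obtain z where z: "norm z \<le> t" "1 \<le> emeasure (\<Xi> \<omega>) {z}"
        using nearest_atom[OF pm] by metis
      have "emeasure (\<Xi> \<omega>) {z} \<le> emeasure (\<Xi> \<omega>) (cball 0 t)"
        using z by (intro emeasure_mono) (auto simp: sets_point_measure[OF pm])
      with z show ?thesis by (auto intro: order_trans)
    qed simp
  qed
  also have "\<dots> = ennreal l * ennreal (unit_ball_vol DIM('a) * t ^ DIM('a))"
    using int emeasure_cball[OF t, of "0::'a"] by (simp add: has_intensity_def)
  also have "\<dots> = ennreal (l * (unit_ball_vol DIM('a) * t ^ DIM('a)))"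
    using l by (simp add: ennreal_mult' t)
  finally show ?thesis using l t by (subst (asm) ennreal_le_iff) auto
qed

lemma empty_space_function_lower:
  fixes \<Xi> :: "'w \<Rightarrow> 'a::euclidean_space measure"
  assumes M: "prob_space M" and gibbs: "gibbs_process M \<Xi> \<Lambda>" and int: "has_intensity M \<Xi> l"
    and c: "0 < c" and stable: "locally_stable \<Lambda> c" and t: "0 \<le> t"
  shows "l / c * (1 - exp (- c * (unit_ball_vol DIM('a) * t ^ DIM('a)))) \<le> empty_space_function M \<Xi> t"
proof -
  interpret prob_space M by fact
  interpret P: pair_sigma_finite "lborel :: 'a measure" M ..
  have \<Xi> [measurable]: "\<Xi> \<in> measurable M config_space"
    and simple: "AE \<omega> in M. simple_config (\<Xi> \<omega>)"
    and \<Lambda> [measurable]: "case_prod \<Lambda> \<in> borel_measurable (borel \<Otimes>\<^sub>M config_space)"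
    using gibbs by (auto simp: gibbs_process_def point_process_def conditional_intensity_def)
  have pm: "\<Xi> \<omega> \<in> point_measures" if "\<omega> \<in> space M" for \<omega>
    using measurable_space[OF \<Xi> that] by (simp add: space_config_space)
  have \<Lambda>_le: "\<Lambda> x (\<Xi> \<omega>) \<le> c" if "\<omega> \<in> space M" for x \<omega>
    using pm[OF that] stable by (auto simp: locally_stable_def)
  have l: "0 \<le> l" using int by (simp add: has_intensity_def)
  note [measurable] = nearest_weight_measurable measurable_emeasure_cball_norm[unfolded case_prod_unfold]

  let ?V = "unit_ball_vol DIM('a) * t ^ DIM('a)"
  let ?w = "shell_weight c t :: 'a \<Rightarrow> real"
  let ?S = "\<lambda>\<omega>. {x::'a. norm x \<le> t \<and> emeasure (\<Xi> \<omega>) (cball 0 (norm x)) \<noteq> 0}"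
  let ?h = "nearest_weight c t :: 'a \<Rightarrow> 'a measure \<Rightarrow> real"
  let ?k = "\<lambda>x \<omega>. ennreal (c * ?w x) * indicator (?S \<omega>) x"
  let ?near = "\<lambda>\<omega>. \<integral>\<^sup>+x. ennreal (?h x (remove_point (\<Xi> \<omega>) x)) \<partial>(\<Xi> \<omega>)"
  let ?far = "\<lambda>\<omega>. \<integral>\<^sup>+x. ?k x \<omega> \<partial>lborel"
  let ?hit = "\<lambda>\<omega>. of_bool (emeasure (\<Xi> \<omega>) (cball 0 t) \<noteq> 0) :: ennreal"

  have [measurable]: "(\<lambda>\<omega>. emeasure (\<Xi> \<omega>) (cball 0 t)) \<in> borel_measurable M"
    by (rule measurable_compose[OF \<Xi> measurable_emeasure_config]) auto
  have [measurable]: "(\<lambda>(x::'a, \<omega>). emeasure (\<Xi> \<omega>) (cball 0 (norm x)))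
      \<in> borel_measurable (lborel \<Otimes>\<^sub>M M)"
  proof -
    have "(\<lambda>(x::'a, \<omega>). (x, \<Xi> \<omega>)) \<in> lborel \<Otimes>\<^sub>M M \<rightarrow>\<^sub>M borel \<Otimes>\<^sub>M config_space" by measurable
    from measurable_compose[OF this measurable_emeasure_cball_norm] show ?thesis
      by (simp add: case_prod_unfold)
  qed
  have k: "case_prod ?k \<in> borel_measurable (lborel \<Otimes>\<^sub>M M)"
  proof -
    have "case_prod ?k = (\<lambda>(x, \<omega>). if norm x \<le> t \<and> emeasure (\<Xi> \<omega>) (cball 0 (norm x)) \<noteq> 0
        then ennreal (c * ?w x) else 0)"
      by (auto simp: indicator_def fun_eq_iff)
    then show ?thesis by simp
  qed
  have far_meas [measurable]: "?far \<in> borel_measurable M"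
    using k by (intro lborel.borel_measurable_nn_integral measurable_pair_swap') auto
  have k_x [measurable]: "(\<lambda>\<omega>. ?k x \<omega>) \<in> borel_measurable M" for x
    using measurable_compose[OF measurable_Pair1'[of x lborel M] k] by simp

  have balance: "AE \<omega> in M. ?near \<omega> + ?far \<omega> \<le> ?hit \<omega>"
    using simple AE_space
  proof eventually_elim
    case (elim \<omega>)
    then show ?case using c by (intro nearest_weight_balance pm) auto
  qed

  have "ennreal (l / c * (1 - exp (- c * ?V)))
      = ennreal l * (\<integral>\<^sup>+x. ennreal (?w x) * indicator (cball 0 t) x \<partial>lborel)"
  proof -
    let ?I = "\<integral>\<^sup>+x. ennreal (?w x) * indicator (cball 0 t) x \<partial>lborel"
    have "{x::'a. 0 \<le> norm x \<and> norm x \<le> t} = cball 0 t" by auto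
    then have "ennreal (1 - exp (- c * ?V))
        = (\<integral>\<^sup>+x. ennreal (c * ?w x) * indicator (cball 0 t) x \<partial>lborel)"
      using nn_integral_shell_weight[where 'a='a, of c 0 t] c t by simp
    also have "\<dots> = (\<integral>\<^sup>+x. ennreal c * (ennreal (?w x) * indicator (cball 0 t) x) \<partial>lborel)"
      using c by (intro nn_integral_cong) (simp add: ennreal_mult' mult.assoc)
    also have "\<dots> = ennreal c * ?I" by (rule nn_integral_cmult) (auto intro!: borel_measurable_times_ennreal borel_measurable_indicator)
    finally have I: "ennreal (1 - exp (- c * ?V)) = ennreal c * ?I" .
    have "ennreal (l / c * (1 - exp (- c * ?V))) = ennreal (l / c) * ennreal (1 - exp (- c * ?V))"
      using l c by (intro ennreal_mult') simp
    also have "\<dots> = (ennreal (l / c) * ennreal c) * ?I" by (simp only: I mult.assoc)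
    also have "ennreal (l / c) * ennreal c = ennreal l"
      using l c by (subst ennreal_mult[symmetric]) auto
    finally show ?thesis .
  qed
  also have "\<dots> = (\<integral>\<^sup>+x. ennreal (?w x) * indicator (cball 0 t) x *
      (\<integral>\<^sup>+\<omega>. ennreal (\<Lambda> x (\<Xi> \<omega>)) \<partial>M) \<partial>lborel)"
    by (rule expected_conditional_intensity[OF M gibbs int, symmetric]) (auto intro!: borel_measurable_times_ennreal borel_measurable_indicator)
  also have "\<dots> = (\<integral>\<^sup>+x. (\<integral>\<^sup>+\<omega>. ennreal (?w x) * indicator (cball 0 t) x * ennreal (\<Lambda> x (\<Xi> \<omega>)) \<partial>M) \<partial>lborel)"
    by (intro nn_integral_cong nn_integral_cmult[symmetric]) measurable
  also have "\<dots> \<le> (\<integral>\<^sup>+x. (\<integral>\<^sup>+\<omega>. ennreal (?h x (\<Xi> \<omega>) * \<Lambda> x (\<Xi> \<omega>)) + ?k x \<omega> \<partial>M) \<partial>lborel)"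
  \<comment> \<open>If the ball up to \<open>x\<close> holds no point, the term with \<open>h\<close> equals the left-hand side; otherwise
    the second term bounds it because \<open>\<Lambda> \<le> c\<close>.\<close>
  proof (intro nn_integral_mono)
    fix x :: 'a and \<omega> assume \<omega>: "\<omega> \<in> space M"
    have "ennreal (?w x) * ennreal (\<Lambda> x (\<Xi> \<omega>)) = ennreal (?w x * \<Lambda> x (\<Xi> \<omega>))"
      by (intro ennreal_mult'[symmetric] shell_weight_nonneg)
    moreover have "ennreal (?w x * \<Lambda> x (\<Xi> \<omega>)) \<le> ennreal (c * ?w x)"
      using \<Lambda>_le[OF \<omega>] shell_weight_nonneg
      by (subst mult.commute[of c]) (intro ennreal_leI mult_left_mono)
    ultimately show "ennreal (?w x) * indicator (cball 0 t) x * ennreal (\<Lambda> x (\<Xi> \<omega>))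
        \<le> ennreal (?h x (\<Xi> \<omega>) * \<Lambda> x (\<Xi> \<omega>)) + ?k x \<omega>"
      by (auto simp: indicator_def nearest_weight_def)
  qed
  also have "\<dots> = (\<integral>\<^sup>+x. (\<integral>\<^sup>+\<omega>. ennreal (?h x (\<Xi> \<omega>) * \<Lambda> x (\<Xi> \<omega>)) \<partial>M) + (\<integral>\<^sup>+\<omega>. ?k x \<omega> \<partial>M) \<partial>lborel)"
    by (intro nn_integral_cong nn_integral_add) measurable
  also have "\<dots> = (\<integral>\<^sup>+x. (\<integral>\<^sup>+\<omega>. ennreal (?h x (\<Xi> \<omega>) * \<Lambda> x (\<Xi> \<omega>)) \<partial>M) \<partial>lborel)
      + (\<integral>\<^sup>+x. (\<integral>\<^sup>+\<omega>. ?k x \<omega> \<partial>M) \<partial>lborel)"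
    using k by (intro nn_integral_add) measurable
  also have "(\<integral>\<^sup>+x. (\<integral>\<^sup>+\<omega>. ennreal (?h x (\<Xi> \<omega>) * \<Lambda> x (\<Xi> \<omega>)) \<partial>M) \<partial>lborel)
      = (\<integral>\<^sup>+\<omega>. ?near \<omega> \<partial>M)"
    using gibbs nearest_weight_measurable[of c t] unfolding gibbs_process_def
    by (elim conjE allE[where x = "?h"]) (auto simp: nearest_weight_def shell_weight_nonneg)
  also have "(\<integral>\<^sup>+x. (\<integral>\<^sup>+\<omega>. ?k x \<omega> \<partial>M) \<partial>lborel) = (\<integral>\<^sup>+\<omega>. ?far \<omega> \<partial>M)"
    by (rule P.Fubini'[OF k, symmetric])
  \<comment> \<open>Replacing the first integrand by a difference avoids the measurability of the integral of \<open>h\<close>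
    with respect to the random measure \<open>\<Xi> \<omega>\<close>.\<close>
  also have "(\<integral>\<^sup>+\<omega>. ?near \<omega> \<partial>M) + (\<integral>\<^sup>+\<omega>. ?far \<omega> \<partial>M)
      \<le> (\<integral>\<^sup>+\<omega>. ?hit \<omega> - ?far \<omega> \<partial>M) + (\<integral>\<^sup>+\<omega>. ?far \<omega> \<partial>M)"
  proof (intro add_right_mono nn_integral_mono_AE)
    show "AE \<omega> in M. ?near \<omega> \<le> ?hit \<omega> - ?far \<omega>"
      using balance
    proof eventually_elim
      case (elim \<omega>)
      then have "?far \<omega> \<le> ?hit \<omega>" by (rule order_trans[OF add_increasing[OF zero_le order_refl]])
      then have "?far \<omega> \<noteq> \<top>" by (cases "emeasure (\<Xi> \<omega>) (cball 0 t) = 0") (auto simp: top_unique)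
      then have "?near \<omega> = (?near \<omega> + ?far \<omega>) - ?far \<omega>" by simp
      also have "\<dots> \<le> ?hit \<omega> - ?far \<omega>" using elim by (intro ennreal_minus_mono) auto
      finally show ?case .
    qed
  qed
  also have "\<dots> = (\<integral>\<^sup>+\<omega>. (?hit \<omega> - ?far \<omega>) + ?far \<omega> \<partial>M)"
    by (rule nn_integral_add[symmetric]) measurable
  also have "\<dots> = (\<integral>\<^sup>+\<omega>. ?hit \<omega> \<partial>M)"
  proof (intro nn_integral_cong_AE)
    show "AE \<omega> in M. ?hit \<omega> - ?far \<omega> + ?far \<omega> = ?hit \<omega>"
      using balance
    proof eventually_elim
      case (elim \<omega>)
      then have "?far \<omega> \<le> ?hit \<omega>" by (rule order_trans[OF add_increasing[OF zero_le order_refl]])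
      then show ?case by (rule diff_add_cancel_ennreal)
    qed
  qed
  also have "\<dots> = ennreal (empty_space_function M \<Xi> t)"
    by (rule emeasure_contact[OF M \<Xi>, symmetric])
  finally show ?thesis
    by (subst (asm) ennreal_le_iff) (auto simp: empty_space_function_def)
qed

theorem mainTheorem3:
  fixes M :: "'w measure"
    and \<Xi> :: "'w \<Rightarrow> 'a::euclidean_space measure"
    and \<Lambda> :: "'a \<Rightarrow> 'a measure \<Rightarrow> real"
    and l c t :: real
  defines "\<alpha> \<equiv> measure lborel (ball (0::'a) 1)"
  assumes "prob_space M"
    and "gibbs_process M \<Xi> \<Lambda>"
    and "stationary M \<Xi>"
    and "has_intensity M \<Xi> l"
    and "c > 0"
    and "locally_stable \<Lambda> c"
    and "t \<ge> 0"
  shows "l / c * (1 - exp (- c * \<alpha> * t ^ DIM('a))) \<le> empty_space_function M \<Xi> t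
       \<and> empty_space_function M \<Xi> t \<le> l * \<alpha> * t ^ DIM('a)"
proof -
  have \<alpha>: "\<alpha> = unit_ball_vol DIM('a)"
    unfolding \<alpha>_def by (simp add: content_ball)
  have \<Xi>: "\<Xi> \<in> measurable M config_space"
    using assms by (auto simp: gibbs_process_def point_process_def)
  show ?thesis
    using empty_space_function_lower[of M \<Xi> \<Lambda> l c t] empty_space_function_upper[of M \<Xi> l t]
      assms(2-) \<Xi> by (simp add: \<alpha> mult.assoc)
qed

end
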